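(* Let $F_1$ and $F_2$ be polynomial-valued functions on finite quivers, with independent parameters $\beta_\varepsilon$ attached to the edges. Assume that: (1) $F_1$ and $F_2$ vanish on disconnected quivers; (2) both functions satisfy the two-vertex contraction rule: for $F\in\{F_1,F_2\}$, every quiver $G$ and every edge $\varepsilon$ of $G$ with distinct endpoints, $$F(G)+F(G_{\bar\varepsilon})+F(G/\varepsilon)=\frac{\beta_\varepsilon+\beta_{\bar\varepsilon}}{2}F(G_{\setminus\varepsilon});$$ (3) for every quiver $G$ and every tadpole $\varepsilon\in E_G$, $F_1(G)=\frac{\beta_\varepsilon-1}{2}F_1(G_{\setminus\varepsilon})$ and $F_2(G)=\frac{\beta_\varepsilon-1}{2}F_2(G_{\setminus\varepsilon})$; (4) for every connected quiver $G$, $F_1(G;\mathbf 1)=F_2(G;\mathbf 1)$, where $F(G;\mathbf 1)$ denotes the value of $F(G)$ when all edge parameters are set equal to $1$. Then $F_1(G)=F_2(G)$ for every quiver $G$.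
   Context: All quivers are finite. A quiver $G=(V_G,E_G,\rho_G)$ consists of finite sets $V_G,E_G$ and a map $\rho_G:E_G\to V_G\times V_G$; $\rho_G(\varepsilon)=(u,v)$ means $\varepsilon$ is directed from $u$ to $v$, written $\varepsilon:u\to v$. Parallel edges, directed cycles and tadpoles (edges $u\to u$) are allowed. $G$ is connected if $V_G\neq\emptyset$ and its underlying undirected graph is connected; otherwise it is called disconnected (in particular the empty quiver counts as disconnected here). Fix a field $\Bbbk$ of characteristic zero. Each edge carries its own indeterminate $\beta_\varepsilon$; a polynomial-valued function $F$ assigns to each quiver $G$ an element $F(G)\in\Bbbk[\beta_\varepsilon:\varepsilon\in E_G]$, compatibly with isomorphisms of quivers. Edges surviving under deletion or contraction keep their parameters. Local modifications at an edge $\varepsilon:i\to j$: $G_{\setminus\varepsilon}$ is obtained by deleting $\varepsilon$ and keeping all vertices. If $i\ne j$, $G_{\bar\varepsilon}$ is obtained by replacing $\varepsilon$ with an edge $\bar\varepsilon:j\to i$ carrying a new independent parameter $\beta_{\bar\varepsilon}$, everything else unchanged, and $G/\varepsilon$ is obtained by removing $\varepsilon$ and identifying $i$ and $j$, keeping every other edge with induced incidence (other edges joining $i$ and $j$ become tadpoles). *)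

theory Defs
  imports "HOL-Library.Poly_Mapping" "HOL-Library.Infinite_Typeclass" "Graph_Theory.Graph_Theory"
begin

section \<open>Multivariate polynomials\<close>

text \<open>Polynomials over \<open>'k\<close> in the indeterminates \<open>\<beta>\<^sub>e\<close>, \<open>e :: 'e\<close>: finitely supported
  coefficient functions on monomials, with the convolution product of \<open>HOL-Library.Poly_Mapping\<close>.\<close>

type_synonym ('e, 'k) mpoly = "('e \<Rightarrow>\<^sub>0 nat) \<Rightarrow>\<^sub>0 'k"

definition Const :: "'k \<Rightarrow> ('e, 'k::comm_ring_1) mpoly" where
  "Const c = Poly_Mapping.single 0 c"

definition Indet :: "'e \<Rightarrow> ('e, 'k::comm_ring_1) mpoly" where
  "Indet e = Poly_Mapping.single (Poly_Mapping.single e 1) 1"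

definition polys_over :: "'e set \<Rightarrow> ('e, 'k::comm_ring_1) mpoly set" where
  "polys_over E = {p. \<forall>m \<in> Poly_Mapping.keys p. Poly_Mapping.keys m \<subseteq> E}"

text \<open>Evaluation at \<open>\<beta>\<^sub>e = \<sigma> e\<close> in a commutative ring, coefficients being mapped along \<open>c\<close>
  (intended to be a ring homomorphism).\<close>

definition eval_mpoly ::
  "('k::comm_ring_1 \<Rightarrow> 'a::comm_ring_1) \<Rightarrow> ('e \<Rightarrow> 'a) \<Rightarrow> ('e, 'k) mpoly \<Rightarrow> 'a" where
  "eval_mpoly c \<sigma> p =
    (\<Sum>m \<in> Poly_Mapping.keys p. c (Poly_Mapping.lookup p m) *
       (\<Prod>e \<in> Poly_Mapping.keys m. \<sigma> e ^ Poly_Mapping.lookup m e))"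

definition rename_mpoly :: "('e \<Rightarrow> 'e) \<Rightarrow> ('e, 'k::comm_ring_1) mpoly \<Rightarrow> ('e, 'k) mpoly" where
  "rename_mpoly f = eval_mpoly Const (\<lambda>e. Indet (f e))"

definition eval_at_ones :: "('e, 'k::comm_ring_1) mpoly \<Rightarrow> 'k" where
  "eval_at_ones = eval_mpoly (\<lambda>x. x) (\<lambda>_. 1)"

lemma eval_mpoly_Indet: "c 1 = 1 \<Longrightarrow> eval_mpoly c \<sigma> (Indet e) = \<sigma> e"
  by (simp add: eval_mpoly_def Indet_def)

lemma eval_mpoly_Const: "c 0 = 0 \<Longrightarrow> eval_mpoly c \<sigma> (Const a) = c a"
  by (simp add: eval_mpoly_def Const_def)


section \<open>Quivers\<close>

text \<open>A finite quiver is a digraph \<open>G\<close> with \<open>fin_digraph G\<close>; loops and parallel arcs are allowed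
  there, and an arc \<open>e\<close> is directed from \<open>tail G e\<close> to \<open>head G e\<close>. Deletion is
  \<open>pre_digraph.del_arc\<close>. The library predicate \<open>connected\<close> (strong connectivity of the
  symmetric closure) requires a nonempty vertex set, so the empty quiver is disconnected.\<close>

text \<open>Replace the arc \<open>e\<close> by an arc named \<open>e'\<close> in the opposite direction; meant for
  \<open>e' \<notin> arcs G\<close>, so that \<open>e'\<close> carries a new parameter.\<close>

definition reverse_arc :: "('v, 'e) pre_digraph \<Rightarrow> 'e \<Rightarrow> 'e \<Rightarrow> ('v, 'e) pre_digraph" where
  "reverse_arc G e e' =
    \<lparr> verts = verts G, arcs = insert e' (arcs G - {e}),
      tail = (tail G)(e' := head G e), head = (head G)(e' := tail G e) \<rparr>"

text \<open>The merged vertex is represented by \<open>tail G e\<close>.\<close>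

definition contract_arc :: "('v, 'e) pre_digraph \<Rightarrow> 'e \<Rightarrow> ('v, 'e) pre_digraph" where
  "contract_arc G e =
    (let q = (\<lambda>v. if v = head G e then tail G e else v) in
     \<lparr> verts = q ` verts G, arcs = arcs G - {e},
       tail = (\<lambda>a. q (tail G a)), head = (\<lambda>a. q (head G a)) \<rparr>)"

lemma fin_digraph_reverse_arc:
  assumes "fin_digraph G" "e \<in> arcs G"
  shows "fin_digraph (reverse_arc G e e')"
proof -
  interpret fin_digraph G by fact
  show ?thesis using assms(2) by unfold_locales (auto simp: reverse_arc_def)
qed

lemma fin_digraph_contract_arc:
  assumes "fin_digraph G"
  shows "fin_digraph (contract_arc G e)"
proof -
  interpret fin_digraph G by fact
  define q where "q = (\<lambda>v. if v = head G e then tail G e else v)"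
  have "contract_arc G e = \<lparr> verts = q ` verts G, arcs = arcs G - {e},
      tail = (\<lambda>a. q (tail G a)), head = (\<lambda>a. q (head G a)) \<rparr>"
    by (simp add: contract_arc_def q_def Let_def)
  then show ?thesis by unfold_locales simp_all
qed


section \<open>Polynomial-valued functions\<close>

text \<open>The values of \<open>F\<close> on records that are not finite quivers are irrelevant. In \<open>app_iso\<close>, the end
  maps of the image are unconstrained off its arc set, so compatibility with isomorphisms also makes
  \<open>F G\<close> independent of the values of \<open>tail G\<close> and \<open>head G\<close> outside \<open>arcs G\<close>.\<close>

definition polynomial_valued ::
  "(('v, 'e) pre_digraph \<Rightarrow> ('e, 'k::comm_ring_1) mpoly) \<Rightarrow> bool" where
  "polynomial_valued F \<longleftrightarrow>
    (\<forall>G. fin_digraph G \<longrightarrow> F G \<in> polys_over (arcs G)) \<and>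
    (\<forall>G h. fin_digraph G \<longrightarrow> pre_digraph.digraph_isomorphism G h \<longrightarrow>
       F (app_iso h G) = rename_mpoly (iso_arcs h) (F G))"

definition vanishes_on_disconnected ::
  "(('v, 'e) pre_digraph \<Rightarrow> ('e, 'k::comm_ring_1) mpoly) \<Rightarrow> bool" where
  "vanishes_on_disconnected F \<longleftrightarrow>
    (\<forall>G. fin_digraph G \<longrightarrow> \<not> Digraph_Component.connected G \<longrightarrow> F G = 0)"

definition two_vertex_contraction_rule ::
  "(('v, 'e) pre_digraph \<Rightarrow> ('e, 'k::field_char_0) mpoly) \<Rightarrow> bool" where
  "two_vertex_contraction_rule F \<longleftrightarrow>
    (\<forall>G e e'. fin_digraph G \<longrightarrow> e \<in> arcs G \<longrightarrow> tail G e \<noteq> head G e \<longrightarrow> e' \<notin> arcs G \<longrightarrow>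
       F G + F (reverse_arc G e e') + F (contract_arc G e) =
       Const (1/2) * (Indet e + Indet e') * F (pre_digraph.del_arc G e))"

definition tadpole_rule ::
  "(('v, 'e) pre_digraph \<Rightarrow> ('e, 'k::field_char_0) mpoly) \<Rightarrow> bool" where
  "tadpole_rule F \<longleftrightarrow>
    (\<forall>G e. fin_digraph G \<longrightarrow> e \<in> arcs G \<longrightarrow> tail G e = head G e \<longrightarrow>
       F G = Const (1/2) * (Indet e - 1) * F (pre_digraph.del_arc G e))"

end

theory Submission
  imports Defs
begin

text \<open>Write \<open>D = F\<^sub>1 - F\<^sub>2\<close> and induct on the number of arcs of \<open>G\<close>. Deletion and contraction remove an
  arc, so the induction hypothesis makes \<open>D\<close> vanish on their results. If \<open>G\<close> has a tadpole, the tadpole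
  rule gives \<open>D(G) = 0\<close> at once. Otherwise the two-vertex rule at an arc \<open>e\<close> collapses to
  \<open>D(G) = - D(G')\<close>, where \<open>G'\<close> is \<open>G\<close> with \<open>e\<close> reversed and renamed to a fresh arc. The right-hand side
  does not involve \<open>\<beta>\<^sub>e\<close>, hence neither does \<open>D(G)\<close>. As \<open>e\<close> was arbitrary, \<open>D(G)\<close> is a constant,
  equal to its value at \<open>\<beta> = 1\<close>. That value is \<open>0\<close>: the two functions agree there on connected quivers
  and both vanish on disconnected ones.\<close>

lemma polys_over_diff:
  assumes "p \<in> polys_over E" "q \<in> polys_over E"
  shows "p - q \<in> polys_over E"
  using assms keys_diff[of p q] unfolding polys_over_def by blast

lemma polys_over_remove_all:
  assumes "p \<in> polys_over E" "\<And>e. e \<in> E \<Longrightarrow> p \<in> polys_over (- {e})"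
  shows "p \<in> polys_over {}"
proof -
  have "Poly_Mapping.keys m = {}" if "m \<in> Poly_Mapping.keys p" for m
    using assms that unfolding polys_over_def by blast
  then show ?thesis by (simp add: polys_over_def)
qed

lemma eval_at_ones_superset:
  assumes "finite A" "Poly_Mapping.keys p \<subseteq> A"
  shows "eval_at_ones p = (\<Sum>m\<in>A. Poly_Mapping.lookup p m)"
proof -
  have "eval_at_ones p = (\<Sum>m\<in>Poly_Mapping.keys p. Poly_Mapping.lookup p m)"
    by (simp add: eval_at_ones_def eval_mpoly_def)
  also have "\<dots> = (\<Sum>m\<in>A. Poly_Mapping.lookup p m)"
    using assms by (intro sum.mono_neutral_left) (auto simp: in_keys_iff)
  finally show ?thesis .
qed

lemma eval_at_ones_diff: "eval_at_ones (p - q) = eval_at_ones p - eval_at_ones q"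
proof -
  let ?A = "Poly_Mapping.keys p \<union> Poly_Mapping.keys q"
  have "Poly_Mapping.keys (p - q) \<subseteq> ?A"
    by (rule keys_diff)
  then show ?thesis
    by (simp add: eval_at_ones_superset[of ?A] lookup_minus sum_subtractf)
qed

lemma constant_eq_0_if_eval_at_ones_eq_0:
  assumes "p \<in> polys_over {}" "eval_at_ones p = 0"
  shows "p = 0"
proof -
  have sub: "Poly_Mapping.keys p \<subseteq> {0}"
    using assms(1) by (auto simp: polys_over_def)
  then have "Poly_Mapping.lookup p 0 = 0"
    using assms(2) eval_at_ones_superset[of "{0}" p] by simp
  then have "0 \<notin> Poly_Mapping.keys p"
    by (simp add: in_keys_iff)
  with sub have "Poly_Mapping.keys p = {}" by blast
  then show ?thesis by simp
qed

theorem theorem5p8: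
  fixes F\<^sub>1 F\<^sub>2 :: "('v::infinite, 'e::infinite) pre_digraph \<Rightarrow> ('e, 'k::field_char_0) mpoly"
  assumes "polynomial_valued F\<^sub>1" and "polynomial_valued F\<^sub>2"
    and "vanishes_on_disconnected F\<^sub>1" and "vanishes_on_disconnected F\<^sub>2"
    and "two_vertex_contraction_rule F\<^sub>1" and "two_vertex_contraction_rule F\<^sub>2"
    and "tadpole_rule F\<^sub>1" and "tadpole_rule F\<^sub>2"
    and "\<And>G. fin_digraph G \<Longrightarrow> Digraph_Component.connected G \<Longrightarrow>
           eval_at_ones (F\<^sub>1 G) = eval_at_ones (F\<^sub>2 G)"
  shows "\<forall>G. fin_digraph G \<longrightarrow> F\<^sub>1 G = F\<^sub>2 G"
proof (intro allI impI)
  fix G :: "('v, 'e) pre_digraph"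
  assume "fin_digraph G"
  then show "F\<^sub>1 G = F\<^sub>2 G"
  proof (induction "card (arcs G)" arbitrary: G rule: less_induct)
    case less
    interpret G: fin_digraph G by fact
    have poly: "F\<^sub>1 H - F\<^sub>2 H \<in> polys_over (arcs H)" if "fin_digraph H" for H
      using assms(1,2) that by (auto simp: polynomial_valued_def intro: polys_over_diff)
    have fewer: "card (arcs G - {e}) < card (arcs G)" if "e \<in> arcs G" for e
      using that G.finite_arcs by (rule card_Diff1_less[rotated])
    have del: "F\<^sub>1 (pre_digraph.del_arc G e) = F\<^sub>2 (pre_digraph.del_arc G e)"
      if e: "e \<in> arcs G" for e
    proof (rule less.hyps)
      show "card (arcs (pre_digraph.del_arc G e)) < card (arcs G)"
        using fewer[OF e] by (simp only: pre_digraph.del_arc_def pre_digraph.select_convs)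
    qed (rule G.fin_digraph_del_arc)
    show ?case
    proof (cases "\<exists>e\<in>arcs G. tail G e = head G e")
      case True
      then obtain e where e: "e \<in> arcs G" "tail G e = head G e" by blast
      have "F G = Const (1/2) * (Indet e - 1) * F (pre_digraph.del_arc G e)"
        if "tadpole_rule F" for F :: "('v, 'e) pre_digraph \<Rightarrow> ('e, 'k) mpoly"
        using that \<open>fin_digraph G\<close> e unfolding tadpole_rule_def by blast
      from this[OF assms(7)] this[OF assms(8)] show ?thesis
        by (simp only: del[OF e(1)])
    next
      case False
      have indep: "F\<^sub>1 G - F\<^sub>2 G \<in> polys_over (- {e})" if e: "e \<in> arcs G" for e
      proof -
        obtain e' where e': "e' \<notin> arcs G"
          using ex_new_if_finite[OF infinite_UNIV G.finite_arcs] by blast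
        let ?R = "reverse_arc G e e'"
        have contr: "F\<^sub>1 (contract_arc G e) = F\<^sub>2 (contract_arc G e)"
        proof (rule less.hyps)
          show "card (arcs (contract_arc G e)) < card (arcs G)"
            using fewer[OF e] by (simp only: contract_arc_def Let_def pre_digraph.select_convs)
        qed (rule fin_digraph_contract_arc[OF \<open>fin_digraph G\<close>])
        have rule: "F G + F ?R + F (contract_arc G e) =
            Const (1/2) * (Indet e + Indet e') * F (pre_digraph.del_arc G e)"
          if "two_vertex_contraction_rule F" for F :: "('v, 'e) pre_digraph \<Rightarrow> ('e, 'k) mpoly"
          using that \<open>fin_digraph G\<close> e e' False unfolding two_vertex_contraction_rule_def by blast
        have "F\<^sub>1 G + F\<^sub>1 ?R = F\<^sub>2 G + F\<^sub>2 ?R"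
          using trans[OF rule[OF assms(5)] rule[OF assms(6), folded del[OF e], symmetric]]
          unfolding contr by (rule add_right_imp_eq)
        then have flip: "F\<^sub>1 G - F\<^sub>2 G = - (F\<^sub>1 ?R - F\<^sub>2 ?R)"
          by (simp add: algebra_simps)
        have "F\<^sub>1 ?R - F\<^sub>2 ?R \<in> polys_over (arcs ?R)"
          by (rule poly[OF fin_digraph_reverse_arc[OF \<open>fin_digraph G\<close> e]])
        moreover have "arcs ?R \<subseteq> - {e}"
          using e e' by (auto simp: reverse_arc_def)
        ultimately show ?thesis
          unfolding flip polys_over_def mem_Collect_eq keys_minus by blast
      qed
      have "F\<^sub>1 G - F\<^sub>2 G \<in> polys_over {}"
        using poly[OF \<open>fin_digraph G\<close>] indep by (rule polys_over_remove_all)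
      moreover have "eval_at_ones (F\<^sub>1 G) = eval_at_ones (F\<^sub>2 G)"
        using assms(3,4) assms(9)[of G] \<open>fin_digraph G\<close>
        by (cases "Digraph_Component.connected G") (auto simp: vanishes_on_disconnected_def)
      ultimately show ?thesis
        using constant_eq_0_if_eval_at_ones_eq_0[of "F\<^sub>1 G - F\<^sub>2 G"]
        by (simp add: eval_at_ones_diff)
    qed
  qed
qed

end
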